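(* Let $H$ be a real Hilbert space, let $K\subset H$ be a non-empty closed convex set, and let $F\colon K\to H$ be bounded on $K$ and strongly pseudomonotone on $K$ with modulus $\gamma=\frac12$. Suppose that the variational inequality $\mathrm{VI}(K,F)$ is solvable and let $x^\ast$ be its solution. Let $p\in\left(\frac12,1\right)$, let $x_1\in K$ and let $x_{k+1}=\mathrm{Pr}_K(x_k-\lambda_kF(x_k))$ with $\lambda_k=\frac1{k^p}$ for all $k\ge1$. Then $\|x^\ast-x_k\|$ converges to $0$ with rate $O\left(k^{\frac12-p}\right)$.
   Context: $H$ carries the inner product $\langle\cdot,\cdot\rangle$ and the induced norm $\|\cdot\|$. $\mathrm{VI}(K,F)$ is the problem of finding $x^\ast\in K$ such that $\langle F(x^\ast),x-x^\ast\rangle\ge 0$ for all $x\in K$; such an $x^\ast$ is called a solution, and $\mathrm{VI}(K,F)$ is solvable if it has a solution (which is then unique under strong pseudomonotonicity). $F$ is strongly pseudomonotone on $K$ with modulus $\gamma>0$ if for all $x,y\in K$: $\langle F(y),x-y\rangle\ge 0$ implies $\langle F(x),x-y\rangle\ge\gamma\|x-y\|^2$. $F$ is bounded on $K$ if there is $M>0$ with $\|F(x)\|\le M$ for all $x\in K$. $\mathrm{Pr}_K(x)$ denotes the metric projection of $x\in H$ onto $K$, i.e. the unique point of $K$ nearest to $x$. A real sequence $\{a_k\}$ converges to $0$ with rate $O(b_k)$, where $b_k\to0$, if there is a constant $C>0$ such that $|a_k|\le C|b_k|$ for all sufficiently large $k$. *)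

theory Defs
  imports "HOL-Analysis.Analysis" "HOL-Library.Landau_Symbols"
begin

definition vi_solution :: "'a::real_inner set \<Rightarrow> ('a \<Rightarrow> 'a) \<Rightarrow> 'a \<Rightarrow> bool" where
  "vi_solution K F z \<longleftrightarrow> z \<in> K \<and> (\<forall>x\<in>K. 0 \<le> F z \<bullet> (x - z))"

definition strongly_pseudomonotone_on ::
    "'a::real_inner set \<Rightarrow> ('a \<Rightarrow> 'a) \<Rightarrow> real \<Rightarrow> bool" where
  "strongly_pseudomonotone_on K F \<gamma> \<longleftrightarrow> 0 < \<gamma> \<and>
     (\<forall>x\<in>K. \<forall>y\<in>K. 0 \<le> F y \<bullet> (x - y) \<longrightarrow> \<gamma> * (norm (x - y))\<^sup>2 \<le> F x \<bullet> (x - y))"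

(* The library's closest_point requires the class heine_borel, which excludes
   infinite-dimensional Hilbert spaces. *)
definition metric_proj :: "'a::metric_space set \<Rightarrow> 'a \<Rightarrow> 'a" where
  "metric_proj K x = (THE z. z \<in> K \<and> (\<forall>y\<in>K. dist x z \<le> dist x y))"

end

theory Submission
  imports Defs
begin

text \<open>Nonexpansiveness of the projection and strong pseudomonotonicity turn the iteration into
  the recursion \<open>d\<^sub>k\<^sub>+\<^sub>1 \<le> (1 - \<lambda>\<^sub>k) d\<^sub>k + M\<^sup>2 \<lambda>\<^sub>k\<^sup>2\<close> for the squared distances
  \<open>d\<^sub>k\<close> to the solution. Put \<open>q = 2p - 1\<close>. Since \<open>(k + 1) powr -q \<ge> (1 - q / k) k powr -q\<close>, the bound
  \<open>d\<^sub>k \<le> C k powr -q\<close> is preserved as soon as \<open>C (k powr (1 - p) - q) \<ge> M\<^sup>2\<close>, for which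
  \<open>C (2 - 2p) \<ge> M\<^sup>2\<close> suffices.\<close>

text \<open>Cantor's intersection theorem takes the place of compactness: the sets
  \<open>S n\<close> of near-minimisers of the squared distance are closed, nonempty and nested, and
  their diameters shrink to 0. Completeness gives a common point, whose squared distance to
  \<open>u\<close> is the infimum.\<close>

lemma ex_nearest_point:
  fixes K :: "'a::{real_inner, complete_space} set"
  assumes "K \<noteq> {}" "closed K" "convex K"
  shows "\<exists>z\<in>K. \<forall>y\<in>K. dist u z \<le> dist u y"
proof -
  define \<delta> where "\<delta> = (INF y\<in>K. (norm (u - y))\<^sup>2)"
  have \<delta>_le: "\<delta> \<le> (norm (u - y))\<^sup>2" if "y \<in> K" for y
    unfolding \<delta>_def by (intro cINF_lower bdd_belowI2[where m = 0] that) auto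
  define S where "S n = {z \<in> K. (norm (u - z))\<^sup>2 \<le> \<delta> + 1 / real (Suc n)}" for n
  have "\<exists>a. \<Inter> (range S) = {a}"
  proof (rule decreasing_closed_nest_sing)
    show "closed (S n)" for n
    proof -
      have "S n = K \<inter> {z. (norm (u - z))\<^sup>2 \<le> \<delta> + 1 / real (Suc n)}"
        by (auto simp: S_def)
      then show ?thesis
        by (simp only:) (intro closed_Int assms closed_Collect_le continuous_intros)
    qed
    show "S n \<noteq> {}" for n
    proof -
      have "(INF y\<in>K. (norm (u - y))\<^sup>2) < \<delta> + 1 / real (Suc n)"
        by (simp add: \<delta>_def)
      then obtain y where "y \<in> K" "(norm (u - y))\<^sup>2 < \<delta> + 1 / real (Suc n)"
        by (subst (asm) cINF_less_iff) (use assms in \<open>auto intro!: bdd_belowI2[where m = 0]\<close>)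
      then show ?thesis by (auto simp: S_def intro: less_imp_le)
    qed
    show "S n \<subseteq> S m" if "m \<le> n" for m n
    proof -
      have "1 / real (Suc n) \<le> 1 / real (Suc m)"
        using that by (intro divide_left_mono) auto
      then show ?thesis by (fastforce simp: S_def)
    qed
    show "\<exists>n. \<forall>z\<in>S n. \<forall>w\<in>S n. dist z w < e" if "e > 0" for e
    proof -
      \<comment> \<open>The midpoint lies in \<open>K\<close>, so the parallelogram law bounds the
        squared distance of two points of \<open>S n\<close> by
        \<open>4 * (\<delta> + 1 / (n + 1)) - 4 * \<delta> = 4 / (n + 1)\<close>; hence the
        threshold \<open>e^2 / 4\<close>.\<close>
      from that obtain n where n: "inverse (real (Suc n)) < e\<^sup>2 / 4"
        using reals_Archimedean[of "e\<^sup>2 / 4"] by auto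
      have "dist z w < e" if "z \<in> S n" "w \<in> S n" for z w
      proof -
        have "midpoint z w \<in> K"
          using that \<open>convex K\<close> by (auto simp: S_def midpoint_def scaleR_add_right convex_def)
        then have "\<delta> \<le> (norm (u - midpoint z w))\<^sup>2"
          by (rule \<delta>_le)
        moreover have "(norm (z - w))\<^sup>2 =
            2 * (norm (u - z))\<^sup>2 + 2 * (norm (u - w))\<^sup>2 - 4 * (norm (u - midpoint z w))\<^sup>2"
        proof -
          have par: "(norm (b - a))\<^sup>2 = 2 * (norm a)\<^sup>2 + 2 * (norm b)\<^sup>2 - (norm (a + b))\<^sup>2" for a b :: 'a
            by (simp add: power2_norm_eq_inner inner_diff_left inner_diff_right
                inner_add_left inner_add_right inner_commute)
          have "(u - z) + (u - w) = 2 *\<^sub>R (u - midpoint z w)"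
            by (simp add: midpoint_def scaleR_diff_right scaleR_2)
          then show ?thesis
            using par[of "u - w" "u - z"] by (simp add: power_mult_distrib)
        qed
        ultimately have "(norm (z - w))\<^sup>2 < e\<^sup>2"
          using that n by (simp add: S_def inverse_eq_divide)
        then show ?thesis
          using \<open>e > 0\<close> power_less_imp_less_base[of "norm (z - w)" 2 e] by (simp add: dist_norm)
      qed
      then show ?thesis by blast
    qed
  qed
  then obtain a where "a \<in> S n" for n by blast
  then have a: "a \<in> K" "(norm (u - a))\<^sup>2 \<le> \<delta> + 1 / real (Suc n)" for n
    by (auto simp: S_def)
  have "(norm (u - a))\<^sup>2 \<le> \<delta>"
  proof (rule field_le_epsilon)
    fix e :: real assume "e > 0"
    then obtain n where "inverse (real (Suc n)) < e"
      using reals_Archimedean by blast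
    with a(2)[of n] show "(norm (u - a))\<^sup>2 \<le> \<delta> + e" by (simp add: inverse_eq_divide)
  qed
  then have "norm (u - a) \<le> norm (u - y)" if "y \<in> K" for y
    by (rule power2_le_imp_le[OF order_trans[OF _ \<delta>_le[OF that]]]) simp
  with a(1) show ?thesis by (auto simp: dist_norm)
qed

text \<open>Convexity makes the nearest point unique, so the definite description in
  \<open>metric_proj\<close> denotes it.\<close>

lemma metric_proj:
  fixes K :: "'a::{real_inner, complete_space} set"
  assumes "K \<noteq> {}" "closed K" "convex K"
  shows metric_proj_in: "metric_proj K u \<in> K"
    and metric_proj_le: "y \<in> K \<Longrightarrow> dist u (metric_proj K u) \<le> dist u y"
proof -
  have "\<exists>!z. z \<in> K \<and> (\<forall>y\<in>K. dist u z \<le> dist u y)"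
    using ex_nearest_point[OF assms, of u] any_closest_point_unique[OF assms(3,2)] by blast
  from theI'[OF this]
  show "metric_proj K u \<in> K" "y \<in> K \<Longrightarrow> dist u (metric_proj K u) \<le> dist u y"
    by (auto simp: metric_proj_def)
qed

text \<open>The angle at the projection between \<open>u\<close> and a point of \<open>K\<close> is
  not acute, so expanding the square of \<open>norm (u - y)\<close> around the projection adds only
  nonnegative terms. It is applied with \<open>y\<close> the solution.\<close>

lemma norm_metric_proj_diff_le:
  fixes K :: "'a::{real_inner, complete_space} set"
  assumes "closed K" "convex K" "y \<in> K"
  shows "norm (metric_proj K u - y) \<le> norm (u - y)"
proof (rule power2_le_imp_le)
  have "K \<noteq> {}" using assms by auto
  note P = metric_proj[OF this assms(1,2), where u = u]
  let ?z = "metric_proj K u"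
  have "(u - ?z) \<bullet> (y - ?z) \<le> 0"
    by (rule any_closest_point_dot[of K]) (use assms P in auto)
  moreover have "(norm (u - y))\<^sup>2 =
      (norm (?z - y))\<^sup>2 + (norm (u - ?z))\<^sup>2 - 2 * ((u - ?z) \<bullet> (y - ?z))"
    by (simp add: power2_norm_eq_inner inner_diff_left inner_diff_right inner_commute algebra_simps)
  ultimately show "(norm (?z - y))\<^sup>2 \<le> (norm (u - y))\<^sup>2"
    using zero_le_power2[of "norm (u - ?z)"] by linarith
qed simp

text \<open>A Bernoulli inequality for the exponent \<open>-q\<close>: after division by
  \<open>k powr -q\<close> it follows from \<open>ln (1 + t) \<le> t\<close> with
  \<open>t = 1 / k\<close> and from \<open>1 + s \<le> exp s\<close>.\<close>

lemma powr_minus_Suc_ge: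
  fixes q :: real
  assumes "0 \<le> q" "k \<ge> 1"
  shows "real k powr (-q) * (1 - q / real k) \<le> real (Suc k) powr (-q)"
proof -
  have k: "real k > 0" using assms by simp
  have "ln (1 + 1 / real k) \<le> 1 / real k"
    using k by (intro ln_add_one_self_le_self) simp
  then have "1 - q / real k \<le> 1 + - q * ln (1 + 1 / real k)"
    using mult_left_mono[OF _ assms(1)] by fastforce
  also have "\<dots> \<le> exp (- q * ln (1 + 1 / real k))"
    by (rule exp_ge_add_one_self)
  also have "\<dots> = (1 + 1 / real k) powr (-q)"
    using add_pos_pos[of 1 "1 / real k"] k by (simp add: powr_def)
  finally have "real k powr (-q) * (1 - q / real k) \<le> real k powr (-q) * (1 + 1 / real k) powr (-q)"
    by (rule mult_left_mono) simp
  also have "\<dots> = (real k * (1 + 1 / real k)) powr (-q)"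
    using k by (simp add: powr_mult)
  also have "real k * (1 + 1 / real k) = real (Suc k)"
    using k by (simp add: field_simps)
  finally show ?thesis .
qed

text \<open>Induction with all changes measured in units of \<open>a / k\<close>, where
  \<open>a = k powr (1 - 2 * p)\<close>: the squared step size equals \<open>a / k\<close>, and the
  contraction factor \<open>1 - l\<close> is weakened to \<open>1 - 1 / k\<close>.\<close>

lemma recursion_bound:
  fixes d :: "nat \<Rightarrow> real" and p B C :: real
  assumes p: "1/2 < p" "p < 1"
    and rec: "\<And>k. k \<ge> 1 \<Longrightarrow> d (Suc k) \<le> (1 - 1 / real k powr p) * d k + B * (1 / real k powr p)\<^sup>2"
    and C: "d 1 \<le> C" "0 \<le> C" "B \<le> C * (2 - 2 * p)"
    and "k \<ge> 1"
  shows "d k \<le> C * real k powr (1 - 2 * p)"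
  using \<open>k \<ge> 1\<close>
proof (induction k rule: dec_induct)
  case base
  then show ?case using C by simp
next
  case (step k)
  define a where "a = real k powr (1 - 2 * p)"
  define l where "l = 1 / real k powr p"
  have k: "real k \<ge> 1" using step by simp
  have a: "a \<ge> 0" by (simp add: a_def)
  \<comment> \<open>This makes \<open>1 - l\<close> nonnegative, so that the induction hypothesis
    may be multiplied by it.\<close>
  have l: "l \<le> 1" using k p by (simp add: l_def ge_one_powr_ge_zero)
  have l2: "l\<^sup>2 = a / real k"
  proof -
    have "l\<^sup>2 = real k powr (-2 * p)"
      by (simp add: l_def power2_eq_square powr_minus powr_add [symmetric] inverse_eq_divide)
    also have "\<dots> = a / real k"
      using k by (simp add: a_def powr_diff powr_minus inverse_eq_divide)
    finally show ?thesis .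
  qed
  have lk: "1 / real k \<le> l"
    unfolding l_def using k p powr_mono[of p 1 "real k"] by (intro divide_left_mono) auto
  have "d (Suc k) \<le> (1 - l) * d k + B * l\<^sup>2"
    using rec[of k] step by (simp add: l_def)
  also have "(1 - l) * d k \<le> (1 - l) * (C * a)"
    using step l by (intro mult_left_mono) (auto simp: a_def)
  also have "(1 - l) * (C * a) \<le> (1 - 1 / real k) * (C * a)"
    using lk a C by (intro mult_right_mono) auto
  \<comment> \<open>Of the decrease \<open>C * a / k\<close>, the perturbation consumes at most the
    fraction \<open>2 - 2 * p\<close>; the remaining fraction \<open>2 * p - 1\<close> covers the
    drop of the power from \<open>k\<close> to \<open>Suc k\<close>.\<close>
  also have "B * l\<^sup>2 \<le> C * (2 - 2 * p) * (a / real k)"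
    unfolding l2 using C a by (intro mult_right_mono) auto
  also have "(1 - 1 / real k) * (C * a) + C * (2 - 2 * p) * (a / real k) =
      C * (a * (1 - (2 * p - 1) / real k))"
    using k by (simp add: field_simps)
  also have "\<dots> \<le> C * real (Suc k) powr (1 - 2 * p)"
    using powr_minus_Suc_ge[of "2 * p - 1" k] step p C
    by (intro mult_left_mono) (auto simp: a_def)
  finally show ?case by simp
qed

theorem theorem5p2:
  fixes K :: "'a::{real_inner, complete_space} set"
    and F :: "'a \<Rightarrow> 'a"
    and xstar :: 'a
    and p :: real
    and x :: "nat \<Rightarrow> 'a"
  assumes "K \<noteq> {}" and "closed K" and "convex K"
    and "bounded (F ` K)"
    and "strongly_pseudomonotone_on K F (1/2)"
    and "vi_solution K F xstar"
    and "1/2 < p" and "p < 1"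
    and "x 1 \<in> K"
    and "\<And>k. k \<ge> 1 \<Longrightarrow>
           x (Suc k) = metric_proj K (x k - (1 / real k powr p) *\<^sub>R F (x k))"
  shows "(\<lambda>k. norm (xstar - x k)) \<longlonglongrightarrow> 0 \<and>
         (\<lambda>k. norm (xstar - x k)) \<in> O(\<lambda>k. real k powr (1/2 - p))"
proof -
  have xs: "xstar \<in> K" "\<And>y. y \<in> K \<Longrightarrow> 0 \<le> F xstar \<bullet> (y - xstar)"
    using assms(6) by (auto simp: vi_solution_def)
  \<comment> \<open>The variational inequality at \<open>xstar\<close> is the premise of strong
    pseudomonotonicity. The modulus 1/2 yields the factor 2 of the cross term in the expanded
    square, hence the contraction factor \<open>1 - l\<close> below.\<close>
  have spm: "(norm (y - xstar))\<^sup>2 \<le> 2 * (F y \<bullet> (y - xstar))" if "y \<in> K" for y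
    using assms(5) xs that by (fastforce simp: strongly_pseudomonotone_on_def)
  obtain M where M: "norm (F y) \<le> M" if "y \<in> K" for y
    using assms(4) by (auto simp: bounded_iff)
  have xK: "x k \<in> K" if "k \<ge> 1" for k
    using that
    by (induction k rule: dec_induct) (use assms metric_proj_in[OF assms(1-3)] in auto)
  define d where "d k = (norm (x k - xstar))\<^sup>2" for k
  \<comment> \<open>The first entry starts the induction at \<open>k = 1\<close>, the second absorbs
    the perturbation in its step.\<close>
  define C where "C = max (d 1) (M\<^sup>2 / (2 - 2 * p))"
  have C: "d 1 \<le> C" "0 \<le> C" "M\<^sup>2 \<le> C * (2 - 2 * p)"
  proof -
    show "d 1 \<le> C" by (simp add: C_def)
    then show "0 \<le> C" by (rule order_trans[rotated]) (simp add: d_def)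
    have "M\<^sup>2 / (2 - 2 * p) \<le> C" by (simp add: C_def)
    then show "M\<^sup>2 \<le> C * (2 - 2 * p)" using assms(8) by (simp add: pos_divide_le_eq)
  qed
  have rec: "d (Suc k) \<le> (1 - 1 / real k powr p) * d k + M\<^sup>2 * (1 / real k powr p)\<^sup>2"
    if "k \<ge> 1" for k
  proof -
    define l where "l = 1 / real k powr p"
    have l: "l \<ge> 0" by (simp add: l_def)
    \<comment> \<open>Since \<open>xstar\<close> lies in \<open>K\<close>, projecting does not move
      the point away from it.\<close>
    have "d (Suc k) \<le> (norm (x k - l *\<^sub>R F (x k) - xstar))\<^sup>2"
      unfolding d_def assms(10)[OF that] l_def[symmetric]
      by (intro power_mono norm_metric_proj_diff_le assms xs xK that) auto
    also have "\<dots> = d k - l * (2 * (F (x k) \<bullet> (x k - xstar))) + l\<^sup>2 * (norm (F (x k)))\<^sup>2"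
      by (simp add: d_def power2_norm_eq_inner inner_diff_left inner_diff_right inner_commute
          power2_eq_square[of l] algebra_simps)
    also have "\<dots> \<le> d k - l * d k + l\<^sup>2 * M\<^sup>2"
      using l spm[OF xK[OF that]] M[OF xK[OF that]]
      by (intro add_mono diff_mono mult_left_mono power_mono) (auto simp: d_def)
    finally show ?thesis by (simp add: l_def algebra_simps)
  qed
  have bound: "norm (xstar - x k) \<le> sqrt C * real k powr (1/2 - p)" if "k \<ge> 1" for k
  proof (rule power2_le_imp_le)
    have "(norm (xstar - x k))\<^sup>2 \<le> C * real k powr (1 - 2 * p)"
      using recursion_bound[OF assms(7,8) rec C that] by (simp add: d_def norm_minus_commute)
    also have "\<dots> = (sqrt C * real k powr (1/2 - p))\<^sup>2"
      using C by (simp add: power_mult_distrib power2_eq_square powr_add[symmetric] algebra_simps)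
    finally show "(norm (xstar - x k))\<^sup>2 \<le> (sqrt C * real k powr (1/2 - p))\<^sup>2" .
  qed (use C in simp)
  \<comment> \<open>One bound gives both conclusions: it has the form of the rate, and its right
    side tends to 0 because \<open>p > 1/2\<close>.\<close>
  have ev: "\<forall>\<^sub>F k in sequentially. norm (norm (xstar - x k)) \<le> sqrt C * real k powr (1/2 - p)"
    using bound by (auto intro: eventually_sequentiallyI[of 1])
  have "(\<lambda>k. real k powr (1/2 - p)) \<longlonglongrightarrow> 0"
    using assms(7) by (intro tendsto_neg_powr filterlim_real_sequentially) simp
  then have "(\<lambda>k. sqrt C * real k powr (1/2 - p)) \<longlonglongrightarrow> 0"
    by (rule tendsto_mult_right_zero)
  with ev have "(\<lambda>k. norm (xstar - x k)) \<longlonglongrightarrow> 0"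
    by (rule Lim_null_comparison)
  moreover have "(\<lambda>k. norm (xstar - x k)) \<in> O(\<lambda>k. real k powr (1/2 - p))"
    by (rule bigoI[where c = "sqrt C"]) (use ev in simp)
  ultimately show ?thesis ..
qed

end
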